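(* Let $r$ be any positive integer. Then $$\sum_{n=0}^{\infty}\sum_{\lambda\in\mathcal{P}(n)}\bigl(\mathrm{mex}(\lambda; r)+\omega_r(\lambda)\bigr)q^{n}=\frac{(q^{r+1};q^{r+1})_{\infty}}{(q;q)_{\infty}}\left(1+\sum_{n=1}^{\infty}\frac{q^{n}(1-q^{rn})}{(1-q^{n})(q^{r+1};q^{r+1})_{n}}\right).$$
   Context: A partition $\lambda$ of a positive integer $n$ is a weakly decreasing sequence of positive integers $\lambda=(\lambda_1,\dots,\lambda_\ell)$ (its parts) with sum $n$; the empty partition is the only partition of $0$. $\mathcal{P}(n)$ is the set of partitions of the non-negative integer $n$. For a positive integer $r$, $\mathcal{P}_r^0(n)$ is the set of partitions of $n$ in which the gap (difference) between any two successive parts is at most $r$ and the smallest part is at most $r$ (the empty partition belongs to $\mathcal{P}_r^0(0)$, the conditions being vacuous), and $\mathcal{P}_r^+(n)=\mathcal{P}(n)\setminus\mathcal{P}_r^0(n)$. The $r$-chain minimal excludant $\mathrm{mex}(\lambda;r)$ of a partition $\lambda$ is the smallest positive integer $k$ such that none of $k,k+1,\dots,k+r-1$ appears as a part of $\lambda$. The weight $\omega_r$ is defined for $\lambda\in\mathcal{P}(n)$ by $\omega_r(\lambda)=0$ if $\lambda\in\mathcal{P}_r^0(n)$ and $\omega_r(\lambda)=r-1$ if $\lambda\in\mathcal{P}_r^+(n)$. $q$-series notation: $(a;q)_0=1$, $(a;q)_n=\prod_{i=0}^{n-1}(1-aq^i)$ for $n\ge 1$, $(a;q)_\infty=\prod_{i=0}^{\infty}(1-aq^i)$;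 here $q\in\mathbb{C}$ with $|q|<1$ (equivalently, the identity is one of formal power series in $q$). *)

theory Defs
  imports "HOL-Analysis.Analysis"
begin

definition partitions :: "nat \<Rightarrow> nat list set" where
  "partitions n = {xs. sorted_wrt (\<ge>) xs \<and> (\<forall>x\<in>set xs. 0 < x) \<and> sum_list xs = n}"

lemma finite_partitions: "finite (partitions n)"
proof (rule finite_subset)
  show "partitions n \<subseteq> {xs. set xs \<subseteq> {..n} \<and> length xs \<le> n}"
  proof
    fix xs assume "xs \<in> partitions n"
    then have pos: "\<forall>x\<in>set xs. 0 < x" and sum: "sum_list xs = n"
      by (auto simp: partitions_def)
    from pos have "length xs \<le> sum_list xs"
      by (induction xs) (auto simp: Suc_le_eq add_less_le_mono)
    with sum show "xs \<in> {xs. set xs \<subseteq> {..n} \<and> length xs \<le> n}"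
      using member_le_sum_list by fastforce
  qed
  show "finite {xs. set xs \<subseteq> {..n} \<and> length xs \<le> n}"
    by (rule finite_lists_length_le) simp
qed

text \<open>Parts are listed in weakly decreasing order, so the truncated differences below are the
  true gaps.\<close>

definition partitions_0 :: "nat \<Rightarrow> nat \<Rightarrow> nat list set" where
  "partitions_0 r n = {xs \<in> partitions n.
     (\<forall>i. Suc i < length xs \<longrightarrow> xs ! i - xs ! Suc i \<le> r) \<and>
     (xs \<noteq> [] \<longrightarrow> Min (set xs) \<le> r)}"

definition partitions_plus :: "nat \<Rightarrow> nat \<Rightarrow> nat list set" where
  "partitions_plus r n = partitions n - partitions_0 r n"

definition chain_mex :: "nat list \<Rightarrow> nat \<Rightarrow> nat" where
  "chain_mex xs r = (LEAST k. 0 < k \<and> (\<forall>j<r. k + j \<notin> set xs))"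

text \<open>The size of the partition \<open>xs\<close> is recovered as \<open>sum_list xs\<close>.\<close>

definition weight :: "nat \<Rightarrow> nat list \<Rightarrow> nat" where
  "weight r xs = (if xs \<in> partitions_plus r (sum_list xs) then r - 1 else 0)"

definition qpoch :: "complex \<Rightarrow> complex \<Rightarrow> nat \<Rightarrow> complex" where
  "qpoch a q n = (\<Prod>i<n. 1 - a * q ^ i)"

definition qpoch_inf :: "complex \<Rightarrow> complex \<Rightarrow> complex" where
  "qpoch_inf a q = (\<Prod>i. 1 - a * q ^ i)"

text \<open>The infinite product is a convergent one whenever \<open>norm q < 1\<close>, so that
  \<^const>\<open>prodinf\<close> has its intended value.\<close>

lemma convergent_prod_qpoch_inf:
  assumes "norm q < 1"
  shows "convergent_prod (\<lambda>i. 1 - a * q ^ i :: complex)"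
proof -
  have "summable (\<lambda>i. norm ((1 - a * q ^ i) - 1))"
    using assms by (simp add: norm_mult norm_power summable_mult summable_geometric)
  then show ?thesis
    by (intro abs_convergent_prod_imp_convergent_prod summable_imp_abs_convergent_prod)
qed

end

theory Submission
  imports Defs
begin

text \<open>A partition with parts \<open>\<lambda>\<^sub>0 \<ge> \<lambda>\<^sub>1 \<ge> \<dots>\<close>, padded with zeros, is determined by its gaps
  \<open>g\<^sub>i = \<lambda>\<^sub>i - \<lambda>\<^sub>i\<^sub>+\<^sub>1\<close>, which form an arbitrary finitely supported sequence of natural numbers, and its
  size is \<open>\<Sum>\<^sub>i (i + 1) g\<^sub>i\<close>. (So \<open>g\<^sub>i\<close> is the multiplicity of the part \<open>i + 1\<close> in the conjugate partition.)
  A statistic that is a product of functions of the individual gaps therefore has a generating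
  function that is a product over \<open>i\<close>.

  The partitions in \<^const>\<open>partitions_0\<close> are those with all gaps at most \<open>r\<close>. In general let \<open>M\<close> be least such that
  the gaps from index \<open>M\<close> on are at most \<open>r\<close>. The parts from index \<open>M\<close> on leave no \<open>r\<close> consecutive
  numbers free up to \<open>\<lambda>\<^sub>M\<close>, whereas, if \<open>M > 0\<close>, a gap larger than \<open>r\<close> lies directly above \<open>\<lambda>\<^sub>M\<close>.
  Hence the chain minimal excludant is \<open>\<lambda>\<^sub>M + 1\<close>. Adding the weight gives \<open>\<lambda>\<^sub>0 + 1\<close> if \<open>M = 0\<close> and
  \<open>\<lambda>\<^sub>M + r\<close> otherwise. In both cases this is
  \<open>[all gaps are at most r] + \<Sum>\<^sub>n [g\<^sub>i \<le> r for all i > n] min r g\<^sub>n\<close>, where a bracket is 1 if the condition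
  in it holds and 0 otherwise: the summands for \<open>n \<ge> M\<close> are \<open>g\<^sub>n\<close>, with sum \<open>\<lambda>\<^sub>M\<close>; if \<open>M > 0\<close>, the
  summand for \<open>n = M - 1\<close> is \<open>r\<close> and those before it vanish; if \<open>M = 0\<close>, the first bracket is 1
  (lemma \<open>chain_mex_plus_weight\<close>).

  Every summand is a product of functions of single gaps. With \<open>x\<^sub>i = q\<^sup>i\<^sup>+\<^sup>1\<close> and \<open>Q = q\<^sup>r\<^sup>+\<^sup>1\<close>, an unrestricted gap
  contributes \<open>1 / (1 - x\<^sub>i)\<close>, a gap bounded by \<open>r\<close> contributes \<open>(1 - Q\<^sup>i\<^sup>+\<^sup>1) / (1 - x\<^sub>i)\<close>, and the factor
  \<open>min r g\<^sub>n\<close> contributes \<open>x\<^sub>n (1 - x\<^sub>n\<^sup>r) / (1 - x\<^sub>n)\<^sup>2\<close>. Multiplied out, these are the two parts of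
  the right-hand side (lemmas \<open>has_sum_bounded_gaps\<close> and \<open>has_sum_gap_share\<close>).

  For the analysis, the products are evaluated on the partitions with at most \<open>K\<close> parts, where only \<open>K\<close>
  gaps matter, and then \<open>K\<close> tends to infinity (\<open>has_sum_all_partitionsI\<close>). The sums over \<open>n\<close> and over the partitions may be exchanged
  because the double sum is dominated by \<open>\<Sum> |\<lambda>| |q|\<^bsup>|\<lambda>|\<^esup>\<close> (\<open>summable_gap_share\<close>).\<close>

section \<open>Partitions and their gap sequences\<close>

definition all_partitions :: "nat list set" where
  "all_partitions = {xs. sorted_wrt (\<ge>) xs \<and> (\<forall>x\<in>set xs. 0 < x)}"

text \<open>Padding with zeros makes the smallest part a gap as well, so that the two conditions defining
  \<^const>\<open>partitions_0\<close> become one.\<close>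

definition part :: "nat list \<Rightarrow> nat \<Rightarrow> nat" where
  "part xs i = (if i < length xs then xs ! i else 0)"

definition gap :: "nat list \<Rightarrow> nat \<Rightarrow> nat" where
  "gap xs i = part xs i - part xs (Suc i)"

lemma partitions_eq: "partitions n = {xs \<in> all_partitions. sum_list xs = n}"
  by (auto simp: partitions_def all_partitions_def)

lemma part_eq_0 [simp]: "length xs \<le> i \<Longrightarrow> part xs i = 0"
  by (simp add: part_def)

lemma gap_eq_0 [simp]: "length xs \<le> i \<Longrightarrow> gap xs i = 0"
  by (simp add: gap_def)

lemma part_pos_iff:
  assumes "xs \<in> all_partitions"
  shows "0 < part xs i \<longleftrightarrow> i < length xs"
  using assms by (auto simp: part_def all_partitions_def)

lemma antimono_part:
  assumes "xs \<in> all_partitions"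
  shows "antimono (part xs)"
proof (rule antimonoI)
  fix i j :: nat assume "i \<le> j"
  then show "part xs j \<le> part xs i"
    using assms sorted_wrt_nth_less[of "(\<ge>)" xs i j]
    by (cases "i = j") (auto simp: part_def all_partitions_def)
qed

lemma part_mem:
  assumes "xs \<in> all_partitions" "0 < part xs i"
  shows "part xs i \<in> set xs"
  using assms by (auto simp: part_def split: if_splits)

lemma part_eq_gap_add:
  assumes "xs \<in> all_partitions"
  shows "part xs i = gap xs i + part xs (Suc i)"
  using antimonoD[OF antimono_part[OF assms], of i "Suc i"] by (simp add: gap_def)

lemma part_eq_sum_gap:
  assumes "xs \<in> all_partitions" "length xs \<le> N"
  shows "part xs i = (\<Sum>j\<in>{i..<N}. gap xs j)"
proof (cases "i \<le> N")
  case True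
  then show ?thesis
  proof (induction i rule: inc_induct)
    case base
    then show ?case using assms by simp
  next
    case (step i)
    then show ?case using part_eq_gap_add[OF assms(1), of i]
      by (simp add: sum.atLeast_Suc_lessThan)
  qed
qed (use assms in simp)

lemma all_partitions_eqI:
  assumes "xs \<in> all_partitions" "ys \<in> all_partitions" "\<And>i. gap xs i = gap ys i"
  shows "xs = ys"
proof -
  have part: "part xs i = part ys i" for i
    using part_eq_sum_gap[OF assms(1), of "max (length xs) (length ys)" i]
      part_eq_sum_gap[OF assms(2), of "max (length xs) (length ys)" i] assms(3) by simp
  have "i < length xs \<longleftrightarrow> i < length ys" for i
    using part_pos_iff[OF assms(1), of i] part_pos_iff[OF assms(2), of i] part by simp
  then have len: "length xs = length ys"
    by (metis less_irrefl linorder_neqE_nat)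
  show ?thesis
  proof (rule nth_equalityI[OF len])
    fix i assume "i < length xs"
    then show "xs ! i = ys ! i" using part[of i] len by (simp add: part_def)
  qed
qed

lemma sum_list_eq_sum_gap:
  assumes "xs \<in> all_partitions" "length xs \<le> N"
  shows "sum_list xs = (\<Sum>j<N. Suc j * gap xs j)"
proof -
  have "sum_list xs = (\<Sum>i<length xs. part xs i)"
    by (simp add: sum_list_sum_nth part_def atLeast0LessThan)
  also have "\<dots> = (\<Sum>i<N. part xs i)"
    using assms(2) by (intro sum.mono_neutral_left) auto
  also have "\<dots> = (\<Sum>i<N. \<Sum>j\<in>{i..<N}. gap xs j)"
    by (simp add: part_eq_sum_gap[OF assms])
  also have "\<dots> = (\<Sum>(i, j)\<in>(SIGMA i:{..<N}. {i..<N}). gap xs j)"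
    by (subst sum.Sigma) auto
  also have "\<dots> = (\<Sum>(j, i)\<in>(SIGMA j:{..<N}. {..j}). gap xs j)"
    by (rule sum.reindex_bij_witness[of _ "\<lambda>(j, i). (i, j)" "\<lambda>(i, j). (j, i)"]) auto
  also have "\<dots> = (\<Sum>j<N. \<Sum>i\<le>j. gap xs j)"
    by (subst sum.Sigma) auto
  finally show ?thesis by simp
qed

text \<open>The parts are the tail sums of \<open>h\<close>. The list has to stop at the end \<open>N\<close> of the support of \<open>h\<close>
  rather than at \<open>K\<close>, since otherwise it would contain zeros.\<close>

lemma exists_partition_with_gaps:
  assumes "\<And>i. K \<le> i \<Longrightarrow> h i = 0"
  shows "\<exists>xs\<in>all_partitions. length xs \<le> K \<and> (\<forall>i. gap xs i = h i)"
proof -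
  define N where "N = (LEAST N. \<forall>i\<ge>N. h i = 0)"
  have N: "\<forall>i\<ge>N. h i = 0"
    unfolding N_def using assms by (rule_tac LeastI[of _ K]) simp
  have "N \<le> K"
    unfolding N_def using assms by (intro Least_le) simp
  have h_pos: "0 < h (N - 1)" if "0 < N"
  proof (rule ccontr)
    assume "\<not> 0 < h (N - 1)"
    then have "\<forall>i\<ge>N - 1. h i = 0"
      using N by (metis Suc_pred' gr0I le_antisym not_less_eq_eq that)
    then have "N \<le> N - 1"
      unfolding N_def by (rule Least_le)
    then show False using that by simp
  qed
  define xs where "xs = map (\<lambda>i. \<Sum>j\<in>{i..<N}. h j) [0..<N]"
  have len: "length xs = N" by (simp add: xs_def)
  have part: "part xs i = (\<Sum>j\<in>{i..<N}. h j)" for i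
    by (simp add: part_def xs_def)
  have pos: "0 < (\<Sum>j\<in>{i..<N}. h j)" if "i < N" for i
  proof -
    have "h (N - 1) \<le> (\<Sum>j\<in>{i..<N}. h j)"
      using that by (intro member_le_sum) auto
    then show ?thesis using h_pos that by linarith
  qed
  have "sorted_wrt (\<ge>) xs"
    by (auto simp: xs_def sorted_wrt_iff_nth_less intro!: sum_mono2)
  then have "xs \<in> all_partitions"
    using pos by (auto simp: all_partitions_def xs_def)
  moreover have "gap xs i = h i" for i
  proof (cases "i < N")
    case True
    then show ?thesis by (simp add: gap_def part sum.atLeast_Suc_lessThan)
  next
    case False
    then show ?thesis using N len by simp
  qed
  ultimately show ?thesis using len \<open>N \<le> K\<close> by blast
qed

lemma bij_betw_gaps:
  "bij_betw (\<lambda>xs. restrict (gap xs) {..<K}) {xs \<in> all_partitions. length xs \<le> K}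
     (PiE {..<K} (\<lambda>_. UNIV))"
proof (rule bij_betw_imageI)
  show "inj_on (\<lambda>xs. restrict (gap xs) {..<K}) {xs \<in> all_partitions. length xs \<le> K}"
  proof (rule inj_onI)
    fix xs ys
    assume xs: "xs \<in> {xs \<in> all_partitions. length xs \<le> K}"
      and ys: "ys \<in> {xs \<in> all_partitions. length xs \<le> K}"
      and eq: "restrict (gap xs) {..<K} = restrict (gap ys) {..<K}"
    have "gap xs i = gap ys i" for i
      using fun_cong[OF eq, of i] xs ys by (cases "i < K") auto
    then show "xs = ys" using xs ys by (auto intro: all_partitions_eqI)
  qed
  show "(\<lambda>xs. restrict (gap xs) {..<K}) ` {xs \<in> all_partitions. length xs \<le> K} =
    PiE {..<K} (\<lambda>_. UNIV)"
  proof (intro equalityI subsetI)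
    fix g assume g: "g \<in> PiE {..<K} (\<lambda>_. UNIV :: nat set)"
    obtain xs where xs: "xs \<in> all_partitions" "length xs \<le> K"
      "\<And>i. gap xs i = (if i < K then g i else 0)"
      using exists_partition_with_gaps[of K "\<lambda>i. if i < K then g i else 0"] by auto
    then have "g = restrict (gap xs) {..<K}"
      using g by (auto simp: fun_eq_iff PiE_def extensional_def)
    then show "g \<in> (\<lambda>xs. restrict (gap xs) {..<K}) ` {xs \<in> all_partitions. length xs \<le> K}"
      using xs by blast
  qed (auto split: if_splits)
qed

section \<open>The chain minimal excludant in terms of the gaps\<close>

text \<open>The contribution of the gap with index \<open>n\<close> to the sum of the chain minimal excludant and the weight.\<close>

definition gap_share :: "nat \<Rightarrow> nat \<Rightarrow> nat list \<Rightarrow> nat" where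
  "gap_share r n xs = (if \<forall>i>n. gap xs i \<le> r then min r (gap xs n) else 0)"

text \<open>The gap at the last index of \<open>xs\<close> is the smallest part; the gaps before it are the differences of
  successive parts.\<close>

lemma partitions_0_iff_gap:
  assumes "xs \<in> all_partitions"
  shows "xs \<in> partitions_0 r (sum_list xs) \<longleftrightarrow> (\<forall>i. gap xs i \<le> r)"
proof -
  have gap_inner: "gap xs i = xs ! i - xs ! Suc i" if "Suc i < length xs" for i
    using that by (simp add: gap_def part_def)
  have gap_last: "gap xs i = Min (set xs)" if "Suc i = length xs" for i
  proof -
    have "Min (set xs) = xs ! i"
    proof (rule Min_eqI)
      fix y assume "y \<in> set xs"
      then obtain j where j: "j < length xs" "y = xs ! j"
        by (auto simp: in_set_conv_nth)
      then show "xs ! i \<le> y"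
        using antimonoD[OF antimono_part[OF assms], of j i] that by (simp add: part_def)
    qed (use that in auto)
    then show ?thesis using that by (simp add: gap_def part_def)
  qed
  have "(\<forall>i. gap xs i \<le> r) \<longleftrightarrow>
    (\<forall>i. Suc i < length xs \<longrightarrow> gap xs i \<le> r) \<and> (\<forall>i. Suc i = length xs \<longrightarrow> gap xs i \<le> r)"
    by (metis gap_eq_0 le0 not_less_eq_eq nat_less_le Suc_leI not_le)
  also have "(\<forall>i. Suc i = length xs \<longrightarrow> gap xs i \<le> r) \<longleftrightarrow> (xs \<noteq> [] \<longrightarrow> Min (set xs) \<le> r)"
    using gap_last by (metis length_0_conv not0_implies_Suc nat.distinct(1))
  finally show ?thesis
    using assms gap_inner by (auto simp: partitions_0_def partitions_eq)
qed

text \<open>Directly above \<open>part xs M\<close> there are \<open>r\<close> free numbers, because the next larger part, if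
  there is one, exceeds it by more than \<open>r\<close>. No window of \<open>r\<close> numbers that starts lower is free, because going up from 0
  to \<open>part xs M\<close> in steps of at most \<open>r\<close> one cannot jump over it.\<close>

lemma chain_mex_eq_part:
  assumes xs: "xs \<in> all_partitions" and "0 < r"
    and small: "\<And>i. M \<le> i \<Longrightarrow> gap xs i \<le> r"
    and big: "0 < M \<Longrightarrow> r < gap xs (M - 1)"
  shows "chain_mex xs r = Suc (part xs M)"
  unfolding chain_mex_def
proof (rule Least_equality)
  note mono = antimonoD[OF antimono_part[OF xs]]
  have "Suc (part xs M) + j \<notin> set xs" if "j < r" for j
  proof
    assume "Suc (part xs M) + j \<in> set xs"
    then obtain i where i: "part xs i = Suc (part xs M) + j"
      by (metis in_set_conv_nth part_def)
    then have "i < M"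
      using mono[of M i] by (cases "i < M") auto
    then have "part xs (M - 1) \<le> part xs i" "0 < M"
      using mono[of i "M - 1"] by auto
    moreover have "part xs (M - 1) = gap xs (M - 1) + part xs M"
      using part_eq_gap_add[OF xs, of "M - 1"] \<open>0 < M\<close> by simp
    ultimately show False using big i \<open>j < r\<close> by linarith
  qed
  then show "0 < Suc (part xs M) \<and> (\<forall>j<r. Suc (part xs M) + j \<notin> set xs)" by blast
  fix k assume k: "0 < k \<and> (\<forall>j<r. k + j \<notin> set xs)"
  show "Suc (part xs M) \<le> k"
  proof (rule ccontr)
    assume "\<not> Suc (part xs M) \<le> k"
    then have "k \<le> part xs M" by simp
    \<comment> \<open>The last part that is at least \<open>k\<close> lies in the window of \<open>r\<close> numbers starting at \<open>k\<close>.\<close>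
    define i where "i = Max {i. k \<le> part xs i}"
    have "{i. k \<le> part xs i} \<subseteq> {..<length xs}"
      using k by (auto simp flip: part_pos_iff[OF xs])
    then have fin: "finite {i. k \<le> part xs i}"
      using finite_subset by blast
    have "i \<in> {i. k \<le> part xs i}"
      unfolding i_def using fin \<open>k \<le> part xs M\<close> by (intro Max_in) auto
    then have i: "k \<le> part xs i" by simp
    have "M \<le> i"
      unfolding i_def using fin \<open>k \<le> part xs M\<close> by (intro Max_ge) auto
    have "part xs (Suc i) < k"
    proof (rule ccontr)
      assume "\<not> part xs (Suc i) < k"
      then have "Suc i \<le> i"
        unfolding i_def using fin by (intro Max_ge) (auto simp flip: i_def)
      then show False by simp
    qed
    then have "part xs i - k < r"
      using part_eq_gap_add[OF xs, of i] small[OF \<open>M \<le> i\<close>] i by linarith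
    then have "k + (part xs i - k) \<notin> set xs" using k by blast
    then show False using part_mem[OF xs, of i] i k by simp
  qed
qed

text \<open>The gap that stops the chain, at index \<open>M - 1\<close>, is larger than \<open>r\<close> and is counted as \<open>r\<close>, which is
  the weight \<open>r - 1\<close> together with the 1 by which the excludant exceeds the part. For partitions
  without such a gap this 1 is the first summand.\<close>

lemma chain_mex_plus_weight:
  assumes xs: "xs \<in> all_partitions" and "0 < r" and N: "length xs \<le> N"
  shows "chain_mex xs r + weight r xs =
    (if \<forall>i. gap xs i \<le> r then 1 else 0) + (\<Sum>n<N. gap_share r n xs)"
proof -
  define M where "M = (LEAST M. \<forall>i\<ge>M. gap xs i \<le> r)"
  have small: "gap xs i \<le> r" if "M \<le> i" for i
  proof -
    have "\<forall>i\<ge>M. gap xs i \<le> r"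
      unfolding M_def by (rule LeastI[of _ N]) (use N in simp)
    then show ?thesis using that by blast
  qed
  have least: "M \<le> m" if "\<forall>i\<ge>m. gap xs i \<le> r" for m
    unfolding M_def using that by (rule Least_le)
  have "M \<le> N" using least[of N] N by simp
  have big: "r < gap xs (M - 1)" if "0 < M"
  proof (rule ccontr)
    assume "\<not> r < gap xs (M - 1)"
    then have "\<forall>i\<ge>M - 1. gap xs i \<le> r"
      using small that by (metis Suc_pred' le_antisym not_less not_less_eq_eq)
    then show False using least[of "M - 1"] that by simp
  qed
  have mex: "chain_mex xs r = Suc (part xs M)"
    by (rule chain_mex_eq_part[OF xs \<open>0 < r\<close> small big])
  have share_after: "gap_share r n xs = gap xs n" if "M \<le> n" for n
    using small that by (simp add: gap_share_def)
  have all_iff: "(\<forall>i. gap xs i \<le> r) \<longleftrightarrow> M = 0"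
    using small least[of 0] by auto
  have weight: "weight r xs = (if M = 0 then 0 else r - 1)"
    using partitions_0_iff_gap[OF xs, of r] all_iff xs
    by (auto simp: weight_def partitions_plus_def partitions_eq)
  have "(\<Sum>n<N. gap_share r n xs) = (\<Sum>n<M. gap_share r n xs) + (\<Sum>n\<in>{M..<N}. gap_share r n xs)"
    using \<open>M \<le> N\<close> by (simp add: sum.atLeastLessThan_concat flip: atLeast0LessThan)
  also have "(\<Sum>n\<in>{M..<N}. gap_share r n xs) = part xs M"
    using part_eq_sum_gap[OF xs N] share_after by simp
  also have "(\<Sum>n<M. gap_share r n xs) = (if M = 0 then 0 else r)"
  proof (cases M)
    case (Suc m)
    have "gap_share r n xs = 0" if "n < m" for n
      using big Suc that by (auto simp: gap_share_def not_le)
    moreover have "gap_share r m xs = r"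
      using small big Suc by (simp add: gap_share_def)
    ultimately show ?thesis using Suc by simp
  qed simp
  finally show ?thesis
    using mex weight all_iff \<open>0 < r\<close> by simp
qed

section \<open>Generating functions over all partitions\<close>

text \<open>Distributivity: by \<open>bij_betw_gaps\<close> the gaps \<open>g\<^sub>0, \<dots>, g\<^sub>K\<^sub>-\<^sub>1\<close> of a partition with at most \<open>K\<close> parts
  run independently through the natural numbers.\<close>

lemma has_sum_prod_gaps:
  fixes f :: "nat \<Rightarrow> nat \<Rightarrow> complex"
  assumes "\<And>i. i < K \<Longrightarrow> (f i has_sum S i) UNIV"
  shows "((\<lambda>xs. \<Prod>i<K. f i (gap xs i)) has_sum (\<Prod>i<K. S i)) {xs \<in> all_partitions. length xs \<le> K}"
proof -
  have abs: "(\<lambda>n. norm (f i n)) summable_on UNIV" if "i < K" for i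
    using assms[OF that] summable_on_iff_abs_summable_on_complex by (auto simp: summable_on_def)
  have "Infinite_Set_Sum.abs_summable_on (\<lambda>g. \<Prod>i<K. f i (g i)) (PiE {..<K} (\<lambda>_. UNIV))"
    by (rule Infinite_Set_Sum.abs_summable_on_prod_PiE)
      (use abs in \<open>auto simp flip: abs_summable_equivalent\<close>)
  then have "(\<lambda>g. \<Prod>i<K. f i (g i)) summable_on (PiE {..<K} (\<lambda>_. UNIV))"
    by (simp add: Infinite_Sum.abs_summable_summable flip: abs_summable_equivalent)
  moreover have "infsum (\<lambda>g. \<Prod>i<K. f i (g i)) (PiE {..<K} (\<lambda>_. UNIV)) = (\<Prod>i<K. S i)"
    using infsumI[OF assms] abs by (subst infsum_prod_PiE_abs) auto
  ultimately have "((\<lambda>g. \<Prod>i<K. f i (g i)) has_sum (\<Prod>i<K. S i)) (PiE {..<K} (\<lambda>_. UNIV))"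
    using has_sum_infsum by fastforce
  then show ?thesis
    by (subst (asm) has_sum_reindex_bij_betw[OF bij_betw_gaps, symmetric]) simp
qed

lemma power_sum_list_eq_prod:
  fixes q :: complex
  assumes "xs \<in> all_partitions" "length xs \<le> K"
  shows "q ^ sum_list xs = (\<Prod>i<K. (q ^ Suc i) ^ gap xs i)"
  by (simp only: sum_list_eq_sum_gap[OF assms] power_sum power_mult)

lemma has_sum_geometric:
  fixes x :: complex
  assumes "norm x < 1"
  shows "((\<lambda>g. x ^ g) has_sum (1 / (1 - x))) UNIV"
  using assms by (intro norm_summable_imp_has_sum geometric_sums)
    (auto simp: norm_power intro: summable_geometric)

lemma has_sum_geometric_bounded:
  fixes x :: complex
  assumes "norm x < 1"
  shows "((\<lambda>g. of_bool (g \<le> r) * x ^ g) has_sum ((1 - x ^ Suc r) / (1 - x))) UNIV"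
proof -
  have "x \<noteq> 1" using assms by auto
  then have "(\<Sum>g\<le>r. x ^ g) = (1 - x ^ Suc r) / (1 - x)"
    by (simp add: sum_gp0 Suc_le_eq lessThan_Suc_atMost)
  then have "((\<lambda>g. x ^ g) has_sum ((1 - x ^ Suc r) / (1 - x))) {..r}"
    by (metis finite_atMost has_sum_finite)
  then show ?thesis
    by (rule has_sum_cong_neutral[THEN iffD1, rotated -1]) auto
qed

text \<open>From \<open>r\<close> to \<open>r + 1\<close> the minimum grows by the indicator of \<open>g > r\<close>, which is the difference of the two
  preceding series.\<close>

lemma has_sum_geometric_min:
  fixes x :: complex
  assumes "norm x < 1"
  shows "((\<lambda>g. of_nat (min r g) * x ^ g) has_sum (x * (1 - x ^ r) / (1 - x)\<^sup>2)) UNIV"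
proof (induction r)
  case (Suc r)
  have "x \<noteq> 1" using assms by auto
  have "((\<lambda>g. of_nat (min r g) * x ^ g + (x ^ g + (- 1) * (of_bool (g \<le> r) * x ^ g))) has_sum
      (x * (1 - x ^ r) / (1 - x)\<^sup>2 + (1 / (1 - x) + (- 1) * ((1 - x ^ Suc r) / (1 - x))))) UNIV"
    by (intro has_sum_add has_sum_cmult_right Suc has_sum_geometric has_sum_geometric_bounded assms)
  also have "(\<lambda>g. of_nat (min r g) * x ^ g + (x ^ g + (- 1) * (of_bool (g \<le> r) * x ^ g))) =
      (\<lambda>g. of_nat (min (Suc r) g) * x ^ g)"
    by (auto simp: fun_eq_iff algebra_simps min_def not_le Suc_le_eq le_Suc_eq)
  also have "x * (1 - x ^ r) / (1 - x)\<^sup>2 + (1 / (1 - x) + (- 1) * ((1 - x ^ Suc r) / (1 - x))) =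
      x * (1 - x ^ Suc r) / (1 - x)\<^sup>2"
    using \<open>x \<noteq> 1\<close> by (simp add: divide_simps power2_eq_square) (simp add: algebra_simps)
  finally show ?case .
qed auto

lemma qpoch_LIMSEQ:
  assumes "norm q < 1"
  shows "qpoch a q \<longlonglongrightarrow> qpoch_inf a q"
  using convergent_prod_LIMSEQ[OF convergent_prod_qpoch_inf[OF assms, of a]]
  unfolding qpoch_def qpoch_inf_def by (subst LIMSEQ_lessThan_iff_atMost)

lemma norm_power_Suc_less_1:
  fixes q :: complex
  assumes "norm q < 1"
  shows "norm (q ^ Suc i) < 1"
  using assms power_Suc_less_one[of "norm q" i] by (cases "q = 0") (auto simp: norm_power norm_mult)

lemma one_minus_power_neq_0:
  fixes q :: complex
  assumes "norm q < 1"
  shows "1 - q ^ Suc i \<noteq> 0"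
  using norm_power_Suc_less_1[OF assms, of i] by auto

lemma qpoch_neq_0:
  assumes "norm q < 1"
  shows "qpoch q q K \<noteq> 0"
  using one_minus_power_neq_0[OF assms] by (auto simp: qpoch_def)

lemma qpoch_inf_neq_0:
  assumes "norm q < 1"
  shows "qpoch_inf q q \<noteq> 0"
  unfolding qpoch_inf_def using one_minus_power_neq_0[OF assms]
  by (intro prodinf_nonzero convergent_prod_qpoch_inf[OF assms]) simp

text \<open>This turns a sum over all partitions into a series, indexed by length or by size.\<close>

lemma has_sum_fibres:
  fixes u :: "'a \<Rightarrow> complex" and h :: "'a \<Rightarrow> nat"
  assumes u: "(u has_sum S) A" and g: "\<And>k. (u has_sum g k) {x \<in> A. h x = k}"
  shows "g sums S"
proof -
  have "A = snd ` Sigma UNIV (\<lambda>k. {x \<in> A. h x = k})" by force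
  with u have "(u has_sum S) (snd ` Sigma UNIV (\<lambda>k. {x \<in> A. h x = k}))" by simp
  then have "((u \<circ> snd) has_sum S) (Sigma UNIV (\<lambda>k. {x \<in> A. h x = k}))"
    by (subst (asm) has_sum_reindex) (auto simp: inj_on_def)
  then have "(g has_sum S) UNIV"
    by (rule has_sum_SigmaD) (use g in simp)
  then show ?thesis by (rule has_sum_imp_sums)
qed

text \<open>For absolutely summable \<open>u\<close> the partial sums of the series indexed by length converge to the sum
  over all partitions, and these are the sums over partitions of bounded length.\<close>

lemma has_sum_all_partitionsI:
  fixes u :: "nat list \<Rightarrow> complex"
  assumes abs: "(\<lambda>xs. norm (u xs)) summable_on all_partitions"
    and fin: "\<forall>\<^sub>F K in sequentially. (u has_sum T K) {xs \<in> all_partitions. length xs \<le> K}"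
    and lim: "T \<longlonglongrightarrow> L"
  shows "(u has_sum L) all_partitions"
proof -
  define A where "A K = {xs \<in> all_partitions. length xs = K}" for K :: nat
  have u: "u summable_on all_partitions"
    using abs summable_on_iff_abs_summable_on_complex by blast
  then have summ: "u summable_on A k" for k
    by (rule summable_on_subset_banach) (auto simp: A_def)
  have "(\<lambda>k. infsum u (A k)) sums infsum u all_partitions"
    using u summ by (intro has_sum_fibres[where u = u and h = length and A = all_partitions])
      (auto simp flip: A_def)
  then have "(\<lambda>K. \<Sum>k\<le>K. infsum u (A k)) \<longlonglongrightarrow> infsum u all_partitions"
    by (simp add: sums_def_le)
  moreover have "(\<Sum>k\<le>K. infsum u (A k)) = infsum u {xs \<in> all_partitions. length xs \<le> K}" for K
  proof -
    have "(\<Sum>k\<le>K. infsum u (A k)) = infsum u (\<Union>k\<le>K. A k)"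
      using summ by (intro sum_infsum) (auto simp: A_def)
    also have "(\<Union>k\<le>K. A k) = {xs \<in> all_partitions. length xs \<le> K}"
      by (auto simp: A_def)
    finally show ?thesis .
  qed
  moreover have "\<forall>\<^sub>F K in sequentially. T K = infsum u {xs \<in> all_partitions. length xs \<le> K}"
    using fin by eventually_elim (simp add: infsumI)
  ultimately have "T \<longlonglongrightarrow> infsum u all_partitions"
    by (simp add: tendsto_cong)
  with lim have "L = infsum u all_partitions" by (rule LIMSEQ_unique)
  with u show ?thesis by simp
qed

lemma has_sum_power_sum_list:
  fixes q :: complex
  assumes "norm q < 1"
  shows "((\<lambda>xs. q ^ sum_list xs) has_sum (1 / qpoch q q K)) {xs \<in> all_partitions. length xs \<le> K}"
proof -
  have "((\<lambda>xs. \<Prod>i<K. (q ^ Suc i) ^ gap xs i) has_sum (\<Prod>i<K. 1 / (1 - q ^ Suc i)))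
      {xs \<in> all_partitions. length xs \<le> K}"
    by (intro has_sum_prod_gaps has_sum_geometric norm_power_Suc_less_1 assms)
  also have "(\<Prod>i<K. 1 / (1 - q ^ Suc i)) = 1 / qpoch q q K"
    by (simp add: prod_dividef qpoch_def)
  finally show ?thesis
    by (rule has_sum_cong[THEN iffD1, rotated]) (auto simp: power_sum_list_eq_prod simp del: power_Suc)
qed

text \<open>The finite sums are bounded because \<open>1 / qpoch t t K\<close> converges as \<open>K\<close> tends to infinity, the infinite
  product being nonzero.\<close>

lemma summable_power_sum_list:
  fixes t :: real
  assumes t: "0 \<le> t" "t < 1"
  shows "(\<lambda>xs. t ^ sum_list xs) summable_on all_partitions"
proof (rule nonneg_bdd_above_summable_on)
  let ?q = "complex_of_real t"
  have q: "norm ?q < 1" using t by simp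
  have "(\<lambda>K. 1 / qpoch ?q ?q K) \<longlonglongrightarrow> 1 / qpoch_inf ?q ?q"
    by (intro tendsto_intros qpoch_LIMSEQ q qpoch_inf_neq_0)
  then have "Bseq (\<lambda>K. 1 / qpoch ?q ?q K)"
    by (meson convergentI convergent_imp_Bseq)
  then obtain C where C: "\<And>K. norm (1 / qpoch ?q ?q K) \<le> C"
    by (auto simp: Bseq_def)
  show "bdd_above (sum (\<lambda>xs. t ^ sum_list xs) ` {F. F \<subseteq> all_partitions \<and> finite F})"
  proof (rule bdd_aboveI2)
    fix F assume F: "F \<in> {F. F \<subseteq> all_partitions \<and> finite F}"
    obtain K where K: "\<And>xs. xs \<in> F \<Longrightarrow> length xs \<le> K"
      using F by (metis (no_types, lifting) finite_imageI finite_nat_set_iff_bounded_le image_eqI mem_Collect_eq)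
    let ?A = "{xs \<in> all_partitions. length xs \<le> K}"
    have hs: "((\<lambda>xs. complex_of_real (t ^ sum_list xs)) has_sum (1 / qpoch ?q ?q K)) ?A"
      using has_sum_power_sum_list[OF q] by simp
    then have "((\<lambda>xs. t ^ sum_list xs) has_sum Re (1 / qpoch ?q ?q K)) ?A"
      using has_sum_Re by fastforce
    then have "(\<Sum>xs\<in>F. t ^ sum_list xs) \<le> Re (1 / qpoch ?q ?q K)"
      using F K t by (intro has_sum_mono2[OF has_sum_finite]) auto
    also have "\<dots> \<le> C"
      using C complex_Re_le_cmod order_trans by blast
    finally show "(\<Sum>xs\<in>F. t ^ sum_list xs) \<le> C" .
  qed
qed (use t in auto)

text \<open>For \<open>t < s < 1\<close> the factor \<open>n\<close> is absorbed by \<open>(t / s)\<^sup>n\<close>, so \<open>n t\<^sup>n\<close> is at most a constant times \<open>s\<^sup>n\<close>.\<close>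

lemma summable_size_times_power:
  fixes t :: real
  assumes t: "0 \<le> t" "t < 1"
  shows "(\<lambda>xs. real (sum_list xs) * t ^ sum_list xs) summable_on all_partitions"
proof -
  define s where "s = (1 + t) / 2"
  have s: "0 < s" "s < 1" "t < s" using t by (auto simp: s_def)
  then have "norm (t / s) < 1" using t by simp
  then have "(\<lambda>n. real n * (t / s) ^ n) \<longlonglongrightarrow> 0"
    by (rule powser_times_n_limit_0)
  then have "Bseq (\<lambda>n. real n * (t / s) ^ n)"
    by (meson convergentI convergent_imp_Bseq)
  then obtain C where C: "\<And>n. norm (real n * (t / s) ^ n) \<le> C"
    by (auto simp: Bseq_def)
  show ?thesis
  proof (rule summable_on_comparison_test)
    show "(\<lambda>xs. C * s ^ sum_list xs) summable_on all_partitions"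
      using s by (intro summable_on_cmult_right summable_power_sum_list) auto
    fix xs :: "nat list"
    let ?n = "sum_list xs"
    have "real ?n * t ^ ?n = (real ?n * (t / s) ^ ?n) * s ^ ?n"
      using s by (simp add: power_divide)
    also have "\<dots> \<le> C * s ^ ?n"
      using s C[of ?n] by (intro mult_right_mono) auto
    finally show "real ?n * t ^ ?n \<le> C * s ^ ?n" .
  qed (use t in auto)
qed

section \<open>Generating functions of the bounded-gap statistics\<close>

lemma prod_of_bool:
  "finite A \<Longrightarrow> (\<Prod>i\<in>A. of_bool (P i) :: 'a :: comm_semiring_1) = of_bool (\<forall>i\<in>A. P i)"
  by (induction A rule: finite_induct) auto

lemma prod_power_eq_qpoch:
  fixes q :: complex
  shows "(\<Prod>i<K. 1 - (q ^ Suc i) ^ Suc r) = qpoch (q ^ (r + 1)) (q ^ (r + 1)) K"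
proof -
  have "(q ^ Suc i) ^ Suc r = q ^ (r + 1) * (q ^ (r + 1)) ^ i" for i
    by (metis Suc_eq_plus1 mult.commute power_Suc power_mult)
  then show ?thesis by (simp only: qpoch_def)
qed

lemma norm_power_plus_1_less_1:
  fixes q :: complex
  assumes "norm q < 1"
  shows "norm (q ^ (r + 1)) < 1"
  using norm_power_Suc_less_1[OF assms, of r] by simp

lemma qpoch_quotient_LIMSEQ:
  assumes "norm q < 1"
  shows "(\<lambda>K. qpoch (q ^ (r + 1)) (q ^ (r + 1)) K / qpoch q q K)
    \<longlonglongrightarrow> qpoch_inf (q ^ (r + 1)) (q ^ (r + 1)) / qpoch_inf q q"
  by (intro tendsto_divide qpoch_LIMSEQ norm_power_plus_1_less_1 assms qpoch_inf_neq_0)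

text \<open>This is the generating function of the partitions in \<^const>\<open>partitions_0\<close>; it gives the term 1 in the
  bracket of the identity.\<close>

lemma has_sum_bounded_gaps:
  fixes q :: complex
  assumes q: "norm q < 1"
  shows "((\<lambda>xs. of_bool (\<forall>i. gap xs i \<le> r) * q ^ sum_list xs) has_sum
    (qpoch_inf (q ^ (r + 1)) (q ^ (r + 1)) / qpoch_inf q q)) all_partitions"
proof (rule has_sum_all_partitionsI)
  have "(\<lambda>xs. norm q ^ sum_list xs) summable_on all_partitions"
    using q by (intro summable_power_sum_list) auto
  then show "(\<lambda>xs. norm (of_bool (\<forall>i. gap xs i \<le> r) * q ^ sum_list xs)) summable_on all_partitions"
    by (rule summable_on_comparison_test) (auto simp: norm_power)
  show "\<forall>\<^sub>F K in sequentially. ((\<lambda>xs. of_bool (\<forall>i. gap xs i \<le> r) * q ^ sum_list xs) has_sum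
      (qpoch (q ^ (r + 1)) (q ^ (r + 1)) K / qpoch q q K)) {xs \<in> all_partitions. length xs \<le> K}"
  proof (rule always_eventually, rule allI)
    fix K
    have "((\<lambda>xs. \<Prod>i<K. of_bool (gap xs i \<le> r) * (q ^ Suc i) ^ gap xs i) has_sum
        (\<Prod>i<K. (1 - (q ^ Suc i) ^ Suc r) / (1 - q ^ Suc i))) {xs \<in> all_partitions. length xs \<le> K}"
      by (intro has_sum_prod_gaps has_sum_geometric_bounded norm_power_Suc_less_1 q)
    also have "(\<Prod>i<K. (1 - (q ^ Suc i) ^ Suc r) / (1 - q ^ Suc i)) =
        qpoch (q ^ (r + 1)) (q ^ (r + 1)) K / qpoch q q K"
      unfolding prod_dividef prod_power_eq_qpoch by (simp add: qpoch_def)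
    finally show "((\<lambda>xs. of_bool (\<forall>i. gap xs i \<le> r) * q ^ sum_list xs) has_sum
        (qpoch (q ^ (r + 1)) (q ^ (r + 1)) K / qpoch q q K)) {xs \<in> all_partitions. length xs \<le> K}"
    proof (rule has_sum_cong[THEN iffD1, rotated])
      fix xs assume xs: "xs \<in> {xs \<in> all_partitions. length xs \<le> K}"
      then have "(\<forall>i\<in>{..<K}. gap xs i \<le> r) \<longleftrightarrow> (\<forall>i. gap xs i \<le> r)"
        by (metis (no_types, lifting) gap_eq_0 le0 le_trans lessThan_iff mem_Collect_eq not_less)
      then show "(\<Prod>i<K. of_bool (gap xs i \<le> r) * (q ^ Suc i) ^ gap xs i) =
          of_bool (\<forall>i. gap xs i \<le> r) * q ^ sum_list xs"
        using xs power_sum_list_eq_prod[of xs K q] by (simp only: prod.distrib prod_of_bool finite_lessThan mem_Collect_eq)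
    qed
  qed
qed (rule qpoch_quotient_LIMSEQ[OF q])

lemma gap_share_eq_prod:
  assumes "length xs \<le> K" "n < K"
  shows "(of_nat (gap_share r n xs) :: complex) =
    (\<Prod>i<K. if i < n then 1 else if i = n then of_nat (min r (gap xs n)) else of_bool (gap xs i \<le> r))"
    (is "_ = prod ?c _")
proof -
  have "prod ?c {..<K} = ?c n * prod ?c ({..<K} - {n})"
    using \<open>n < K\<close> by (intro prod.remove) auto
  also have "prod ?c ({..<K} - {n}) = (\<Prod>i\<in>{..<K} - {n}. of_bool (n < i \<longrightarrow> gap xs i \<le> r))"
    by (intro prod.cong) auto
  also have "\<dots> = of_bool (\<forall>i\<in>{..<K} - {n}. n < i \<longrightarrow> gap xs i \<le> r)"
    by (rule prod_of_bool) simp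
  also have "(\<forall>i\<in>{..<K} - {n}. n < i \<longrightarrow> gap xs i \<le> r) \<longleftrightarrow> (\<forall>i>n. gap xs i \<le> r)"
  proof (intro iffI allI impI)
    fix i assume "\<forall>i\<in>{..<K} - {n}. n < i \<longrightarrow> gap xs i \<le> r" "n < i"
    then show "gap xs i \<le> r" using assms(1) by (cases "i < K") auto
  qed auto
  finally show ?thesis by (simp add: gap_share_def)
qed

text \<open>The gaps before \<open>n\<close> are free, so the numerators \<open>1 - Q\<^sup>i\<^sup>+\<^sup>1\<close> occur only for \<open>n < i < K\<close>; their product is
  \<open>qpoch Q Q K / qpoch Q Q (n + 1)\<close>.\<close>

lemma has_sum_gap_share_length_le:
  fixes q :: complex and n r :: nat
  assumes q: "norm q < 1" and "n < K"
  defines "x \<equiv> q ^ Suc n" and "Q \<equiv> q ^ (r + 1)"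
  shows "((\<lambda>xs. of_nat (gap_share r n xs) * q ^ sum_list xs) has_sum
    (x * (1 - x ^ r) / ((1 - x) * qpoch Q Q (Suc n)) * (qpoch Q Q K / qpoch q q K)))
    {xs \<in> all_partitions. length xs \<le> K}"
proof -
  define c :: "nat \<Rightarrow> nat \<Rightarrow> complex" where
    "c i g = (if i < n then 1 else if i = n then of_nat (min r g) else of_bool (g \<le> r))" for i g
  \<comment> \<open>Summing over the gap at index \<open>i\<close> gives \<open>e i / (1 - q ^ Suc i)\<close>; one of the two factors
    \<open>1 - x\<close> in the denominator for \<open>i = n\<close> is therefore left in \<open>e n\<close>.\<close>
  define e where
    "e i = (if i < n then 1 else if i = n then x * (1 - x ^ r) / (1 - x) else 1 - (q ^ Suc i) ^ Suc r)" for i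
  have "((\<lambda>g. c i g * (q ^ Suc i) ^ g) has_sum (e i / (1 - q ^ Suc i))) UNIV" for i
  proof -
    note y = norm_power_Suc_less_1[OF q, of i]
    consider "i < n" | "i = n" | "n < i" by linarith
    then show ?thesis
    proof cases
      case 1
      then show ?thesis using has_sum_geometric[OF y] by (simp add: c_def e_def)
    next
      case 2
      then show ?thesis using has_sum_geometric_min[OF y, of r]
        by (simp add: c_def e_def x_def power2_eq_square)
    next
      case 3
      then show ?thesis using has_sum_geometric_bounded[OF y, of r] by (simp add: c_def e_def)
    qed
  qed
  then have "((\<lambda>xs. \<Prod>i<K. c i (gap xs i) * (q ^ Suc i) ^ gap xs i) has_sum
      (\<Prod>i<K. e i / (1 - q ^ Suc i))) {xs \<in> all_partitions. length xs \<le> K}"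
    by (rule has_sum_prod_gaps)
  also have "(\<Prod>i<K. e i / (1 - q ^ Suc i)) =
      x * (1 - x ^ r) / ((1 - x) * qpoch Q Q (Suc n)) * (qpoch Q Q K / qpoch q q K)"
  proof -
    have Q_neq_0: "qpoch Q Q j \<noteq> 0" for j
      unfolding Q_def by (intro qpoch_neq_0 norm_power_plus_1_less_1 q)
    have "Suc n \<le> K" using \<open>n < K\<close> by simp
    then have "prod e {..<K} * qpoch Q Q (Suc n) = x * (1 - x ^ r) / (1 - x) * qpoch Q Q K"
    proof (induction K rule: dec_induct)
      case base
      have "prod e {..<n} = 1" by (intro prod.neutral) (simp add: e_def)
      then show ?case by (simp add: e_def)
    next
      case (step K)
      have "qpoch Q Q (Suc K) = qpoch Q Q K * e K"
        using step.hyps unfolding Q_def prod_power_eq_qpoch[symmetric] by (simp add: e_def)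
      moreover have "prod e {..<Suc K} * qpoch Q Q (Suc n) = prod e {..<K} * qpoch Q Q (Suc n) * e K"
        by (simp add: mult_ac)
      ultimately show ?case unfolding step.IH by (simp add: mult_ac)
    qed
    then have "prod e {..<K} = x * (1 - x ^ r) / ((1 - x) * qpoch Q Q (Suc n)) * qpoch Q Q K"
      using Q_neq_0[of "Suc n"] by (simp add: nonzero_eq_divide_eq[symmetric])
    then show ?thesis by (simp add: prod_dividef qpoch_def)
  qed
  finally show ?thesis
  proof (rule has_sum_cong[THEN iffD1, rotated])
    fix xs assume xs: "xs \<in> {xs \<in> all_partitions. length xs \<le> K}"
    then have "(\<Prod>i<K. c i (gap xs i)) = of_nat (gap_share r n xs)"
      using gap_share_eq_prod[of xs K n r] \<open>n < K\<close> by (simp add: c_def cong: if_cong)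
    then show "(\<Prod>i<K. c i (gap xs i) * (q ^ Suc i) ^ gap xs i) =
        of_nat (gap_share r n xs) * q ^ sum_list xs"
      using xs power_sum_list_eq_prod[of xs K q] by (simp only: prod.distrib mem_Collect_eq)
  qed
qed

lemma has_sum_gap_share:
  fixes q :: complex and n r :: nat
  assumes q: "norm q < 1"
  defines "Q \<equiv> q ^ (r + 1)"
  shows "((\<lambda>xs. of_nat (gap_share r n xs) * q ^ sum_list xs) has_sum
    (q ^ Suc n * (1 - q ^ (r * Suc n)) / ((1 - q ^ Suc n) * qpoch Q Q (Suc n)) *
      (qpoch_inf Q Q / qpoch_inf q q))) all_partitions"
proof (rule has_sum_all_partitionsI)
  have "(\<lambda>xs. real r * norm q ^ sum_list xs) summable_on all_partitions"
    using q by (intro summable_on_cmult_right summable_power_sum_list) auto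
  then show "(\<lambda>xs. norm (of_nat (gap_share r n xs) * q ^ sum_list xs)) summable_on all_partitions"
    by (rule summable_on_comparison_test)
      (auto simp: norm_mult norm_power gap_share_def intro!: mult_right_mono)
  have *: "q ^ (r * Suc n) = (q ^ Suc n) ^ r"
    by (metis mult.commute power_mult)
  show "\<forall>\<^sub>F K in sequentially. ((\<lambda>xs. of_nat (gap_share r n xs) * q ^ sum_list xs) has_sum
      (q ^ Suc n * (1 - q ^ (r * Suc n)) / ((1 - q ^ Suc n) * qpoch Q Q (Suc n)) *
        (qpoch Q Q K / qpoch q q K))) {xs \<in> all_partitions. length xs \<le> K}"
    unfolding Q_def * using eventually_gt_at_top[of n]
    by eventually_elim (rule has_sum_gap_share_length_le[OF q])
qed (unfold Q_def, intro tendsto_mult tendsto_const qpoch_quotient_LIMSEQ q)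

section \<open>Exchanging the two summations\<close>

lemma has_sum_gap_share_index:
  fixes c :: "'a :: real_normed_field"
  shows "((\<lambda>n. of_nat (gap_share r n xs) * c) has_sum (of_nat (\<Sum>n<length xs. gap_share r n xs) * c)) UNIV"
proof -
  have "((\<lambda>n. of_nat (gap_share r n xs) * c) has_sum
      (\<Sum>n<length xs. of_nat (gap_share r n xs) * c)) {..<length xs}"
    by simp
  then have "((\<lambda>n. of_nat (gap_share r n xs) * c) has_sum
      (\<Sum>n<length xs. of_nat (gap_share r n xs) * c)) UNIV"
    by (rule has_sum_cong_neutral[THEN iffD1, rotated -1]) (auto simp: gap_share_def)
  then show ?thesis by (simp add: sum_distrib_right)
qed

text \<open>For a fixed partition, the shares sum to at most the sum of all gaps, hence to at most the
  size.\<close>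

lemma summable_gap_share:
  fixes q :: complex
  assumes q: "norm q < 1"
  shows "(\<lambda>(xs, n). of_nat (gap_share r n xs) * q ^ sum_list xs) summable_on (all_partitions \<times> UNIV)"
proof -
  let ?G = "\<lambda>xs. \<Sum>n<length xs. gap_share r n xs"
  have "(\<lambda>(xs, n). real (gap_share r n xs) * norm q ^ sum_list xs) summable_on (all_partitions \<times> UNIV)"
  proof (rule summable_on_SigmaI)
    fix xs
    show "((\<lambda>n. case (xs, n) of (xs, n) \<Rightarrow> real (gap_share r n xs) * norm q ^ sum_list xs) has_sum
        real (?G xs) * norm q ^ sum_list xs) UNIV"
      using has_sum_gap_share_index[of r xs "norm q ^ sum_list xs"] by simp
  next
    have "(\<lambda>xs. real (sum_list xs) * norm q ^ sum_list xs) summable_on all_partitions"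
      using q by (intro summable_size_times_power) auto
    then show "(\<lambda>xs. real (?G xs) * norm q ^ sum_list xs) summable_on all_partitions"
    proof (rule summable_on_comparison_test)
      fix xs assume "xs \<in> all_partitions"
      then have "sum_list xs = (\<Sum>n<length xs. Suc n * gap xs n)"
        by (rule sum_list_eq_sum_gap) simp
      also have "?G xs \<le> \<dots>"
        by (intro sum_mono) (auto simp: gap_share_def)
      finally show "real (?G xs) * norm q ^ sum_list xs \<le> real (sum_list xs) * norm q ^ sum_list xs"
        by (intro mult_right_mono of_nat_mono) auto
    qed (auto intro!: mult_nonneg_nonneg sum_nonneg)
  qed auto
  then show ?thesis
    by (subst summable_on_iff_abs_summable_on_complex)
      (simp add: case_prod_unfold norm_mult norm_power)
qed

theorem theorem1p7:
  fixes r :: nat and q :: complex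
  assumes "r \<ge> 1" and "norm q < 1"
  shows "summable (\<lambda>n. q ^ Suc n * (1 - q ^ (r * Suc n)) /
             ((1 - q ^ Suc n) * qpoch (q ^ (r + 1)) (q ^ (r + 1)) (Suc n))) \<and>
         (\<lambda>n. (\<Sum>xs\<in>partitions n. of_nat (chain_mex xs r + weight r xs)) * q ^ n) sums
           (qpoch_inf (q ^ (r + 1)) (q ^ (r + 1)) / qpoch_inf q q *
             (1 + (\<Sum>n. q ^ Suc n * (1 - q ^ (r * Suc n)) /
                   ((1 - q ^ Suc n) * qpoch (q ^ (r + 1)) (q ^ (r + 1)) (Suc n)))))"
proof -
  define a where "a n = q ^ Suc n * (1 - q ^ (r * Suc n)) /
    ((1 - q ^ Suc n) * qpoch (q ^ (r + 1)) (q ^ (r + 1)) (Suc n))" for n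
  define B where "B = qpoch_inf (q ^ (r + 1)) (q ^ (r + 1)) / qpoch_inf q q"
  note q = \<open>norm q < 1\<close>
  have "B \<noteq> 0"
    unfolding B_def using qpoch_inf_neq_0 norm_power_plus_1_less_1 q by simp
  let ?u = "\<lambda>xs n. of_nat (gap_share r n xs) * q ^ sum_list xs"
  let ?G = "\<lambda>xs. \<Sum>n<length xs. gap_share r n xs"
  obtain L where L: "((\<lambda>(xs, n). ?u xs n) has_sum L) (all_partitions \<times> UNIV)"
    using summable_gap_share[OF q] by (auto simp: summable_on_def)
  have G: "((\<lambda>xs. of_nat (?G xs) * q ^ sum_list xs) has_sum L) all_partitions"
    by (rule has_sum_SigmaD[OF L]) (use has_sum_gap_share_index in simp)
  have "((\<lambda>(n, xs). ?u xs n) has_sum L) (UNIV \<times> all_partitions)"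
    using L by (subst has_sum_swap) simp
  then have "((\<lambda>n. a n * B) has_sum L) UNIV"
    by (rule has_sum_SigmaD) (use has_sum_gap_share[OF q, of r] in \<open>simp add: a_def B_def\<close>)
  then have "(\<lambda>n. a n * B) sums L"
    by (rule has_sum_imp_sums)
  then have "a sums (L / B)"
    using \<open>B \<noteq> 0\<close> sums_divide[of "\<lambda>n. a n * B" L B] by simp
  then have a: "summable a" "L = B * suminf a"
    using \<open>B \<noteq> 0\<close> by (auto simp: sums_iff)
  have "((\<lambda>xs. of_bool (\<forall>i. gap xs i \<le> r) * q ^ sum_list xs + of_nat (?G xs) * q ^ sum_list xs)
      has_sum (B + L)) all_partitions"
    unfolding B_def by (intro has_sum_add G has_sum_bounded_gaps q)
  then have total: "((\<lambda>xs. of_nat (chain_mex xs r + weight r xs) * q ^ sum_list xs) has_sum (B + L)) all_partitions"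
    by (rule has_sum_cong[THEN iffD1, rotated])
      (use chain_mex_plus_weight[OF _ _ order_refl, of _ r] \<open>r \<ge> 1\<close> in \<open>simp add: algebra_simps\<close>)
  have "(\<lambda>n. (\<Sum>xs\<in>partitions n. of_nat (chain_mex xs r + weight r xs)) * q ^ n) sums (B + L)"
  proof (rule has_sum_fibres[OF total, where h = sum_list])
    fix n
    show "((\<lambda>xs. of_nat (chain_mex xs r + weight r xs) * q ^ sum_list xs) has_sum
        (\<Sum>xs\<in>partitions n. of_nat (chain_mex xs r + weight r xs)) * q ^ n)
        {xs \<in> all_partitions. sum_list xs = n}"
      unfolding partitions_eq[symmetric] sum_distrib_right
      by (intro has_sum_finiteI finite_partitions sum.cong) (auto simp: partitions_eq)
  qed
  then show ?thesis
    using a unfolding a_def[symmetric] B_def[symmetric] by (simp add: distrib_left)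
qed

end
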